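(* Let $L$ be a Boolean algebra. Then: (1) the Boolean algebra $(L,\wedge,\vee,{}^\ast,0,1)$ is isomorphic to the Boolean algebra $(D(L),\sqcap,\sqcup,\star,d_0,d_1)$; (2) the Boolean algebra $(L,\wedge,\vee,{}^\ast,0,1)$ is isomorphic to the Boolean algebra $(G(L),\cap,\cup,\bullet,g_0,g_1)$.
   Context: Boolean algebras are regarded as the MV-algebras $(L,\oplus,{}^\ast,0)$ in which $x\oplus x=x$ for all $x$; then $\oplus=\vee$, $x\odot y:=(x^\ast\oplus y^\ast)^\ast=x\wedge y$, $1=0^\ast$, ${}^\ast$ is complementation, and $B(L)=\{a\in L\mid a\oplus a=a\}=L$. For $a\in L$ define maps $L\to L$ by $d_a(x)=x\odot a$ and $g_a(x)=a\oplus x$. Let $D(L)=\{d_a\mid a\in B(L)\}$ and $G(L)=\{g_a\mid a\in B(L)\}$. The operations on $D(L)$ are $(d_a\sqcup d_b)(x)=d_a(x)\vee d_b(x)$, $(d_a\sqcap d_b)(x)=d_a(x)\wedge d_b(x)$, $(d_a)^\star=d_{a^\ast}$; the operations on $G(L)$ are $(g_a\cup g_b)(x)=g_a(x)\vee g_b(x)$, $(g_a\cap g_b)(x)=g_a(x)\wedge g_b(x)$, $(g_a)^\bullet=g_{a^\ast}$. In the tuples, the listed operations are meet, join, complement, bottom, top, in this order. *)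

theory Defs
  imports "HOL-Algebra.Congruence"
begin

record 'a mv = "'a partial_object" +
  mv_plus :: "['a, 'a] \<Rightarrow> 'a" (infixl "\<oplus>\<index>" 65)
  mv_neg  :: "'a \<Rightarrow> 'a" ("neg\<index> _" [81] 80)
  mv_zero :: "'a" ("\<zero>\<index>")

locale mv_algebra =
  fixes L :: "('a, 'm) mv_scheme" (structure)
  assumes plus_closed: "\<lbrakk>x \<in> carrier L; y \<in> carrier L\<rbrakk> \<Longrightarrow> x \<oplus> y \<in> carrier L"
    and neg_closed: "x \<in> carrier L \<Longrightarrow> neg x \<in> carrier L"
    and zero_closed: "\<zero> \<in> carrier L"
    and plus_assoc: "\<lbrakk>x \<in> carrier L; y \<in> carrier L; z \<in> carrier L\<rbrakk>
          \<Longrightarrow> (x \<oplus> y) \<oplus> z = x \<oplus> (y \<oplus> z)"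
    and plus_comm: "\<lbrakk>x \<in> carrier L; y \<in> carrier L\<rbrakk> \<Longrightarrow> x \<oplus> y = y \<oplus> x"
    and plus_zero: "x \<in> carrier L \<Longrightarrow> x \<oplus> \<zero> = x"
    and neg_neg: "x \<in> carrier L \<Longrightarrow> neg (neg x) = x"
    and plus_neg_zero: "x \<in> carrier L \<Longrightarrow> x \<oplus> neg \<zero> = neg \<zero>"
    and lukasiewicz: "\<lbrakk>x \<in> carrier L; y \<in> carrier L\<rbrakk>
          \<Longrightarrow> neg (neg x \<oplus> y) \<oplus> y = neg (neg y \<oplus> x) \<oplus> x"

locale boolean_mv_algebra = mv_algebra +
  assumes plus_idem: "x \<in> carrier L \<Longrightarrow> x \<oplus> x = x"

definition mv_one :: "('a, 'm) mv_scheme \<Rightarrow> 'a" ("\<one>\<index>")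
  where "\<one>\<^bsub>L\<^esub> = neg\<^bsub>L\<^esub> \<zero>\<^bsub>L\<^esub>"

definition mv_times :: "('a, 'm) mv_scheme \<Rightarrow> 'a \<Rightarrow> 'a \<Rightarrow> 'a" (infixl "\<odot>\<index>" 70)
  where "x \<odot>\<^bsub>L\<^esub> y = neg\<^bsub>L\<^esub> (neg\<^bsub>L\<^esub> x \<oplus>\<^bsub>L\<^esub> neg\<^bsub>L\<^esub> y)"

text \<open>The lattice operations of the natural order of an MV-algebra.\<close>

definition mv_join :: "('a, 'm) mv_scheme \<Rightarrow> 'a \<Rightarrow> 'a \<Rightarrow> 'a" (infixl "\<squnion>\<index>" 65)
  where "x \<squnion>\<^bsub>L\<^esub> y = (x \<odot>\<^bsub>L\<^esub> neg\<^bsub>L\<^esub> y) \<oplus>\<^bsub>L\<^esub> y"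

definition mv_meet :: "('a, 'm) mv_scheme \<Rightarrow> 'a \<Rightarrow> 'a \<Rightarrow> 'a" (infixl "\<sqinter>\<index>" 70)
  where "x \<sqinter>\<^bsub>L\<^esub> y = x \<odot>\<^bsub>L\<^esub> (neg\<^bsub>L\<^esub> x \<oplus>\<^bsub>L\<^esub> y)"

definition boolean_center :: "('a, 'm) mv_scheme \<Rightarrow> 'a set"
  where "boolean_center L = {a \<in> carrier L. a \<oplus>\<^bsub>L\<^esub> a = a}"

text \<open>Maps on the carrier are extensional: outside of the carrier they are undefined,
  so that equality of maps is equality on the carrier.\<close>

definition d_map :: "('a, 'm) mv_scheme \<Rightarrow> 'a \<Rightarrow> 'a \<Rightarrow> 'a"
  where "d_map L a = (\<lambda>x\<in>carrier L. x \<odot>\<^bsub>L\<^esub> a)"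

definition g_map :: "('a, 'm) mv_scheme \<Rightarrow> 'a \<Rightarrow> 'a \<Rightarrow> 'a"
  where "g_map L a = (\<lambda>x\<in>carrier L. a \<oplus>\<^bsub>L\<^esub> x)"

definition D_set :: "('a, 'm) mv_scheme \<Rightarrow> ('a \<Rightarrow> 'a) set"
  where "D_set L = {d_map L a |a. a \<in> boolean_center L}"

definition G_set :: "('a, 'm) mv_scheme \<Rightarrow> ('a \<Rightarrow> 'a) set"
  where "G_set L = {g_map L a |a. a \<in> boolean_center L}"

definition pointwise_join :: "('a, 'm) mv_scheme \<Rightarrow> ('a \<Rightarrow> 'a) \<Rightarrow> ('a \<Rightarrow> 'a) \<Rightarrow> 'a \<Rightarrow> 'a"
  where "pointwise_join L f g = (\<lambda>x\<in>carrier L. f x \<squnion>\<^bsub>L\<^esub> g x)"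

definition pointwise_meet :: "('a, 'm) mv_scheme \<Rightarrow> ('a \<Rightarrow> 'a) \<Rightarrow> ('a \<Rightarrow> 'a) \<Rightarrow> 'a \<Rightarrow> 'a"
  where "pointwise_meet L f g = (\<lambda>x\<in>carrier L. f x \<sqinter>\<^bsub>L\<^esub> g x)"

text \<open>The complements are given on generators by \<open>d_a \<mapsto> d_(neg a)\<close> and \<open>g_a \<mapsto> g_(neg a)\<close>.
  The index \<open>a\<close> is determined by the map, since \<open>d_a\<close> sends the top element to \<open>a\<close>
  and \<open>g_a\<close> sends the bottom element to \<open>a\<close>; the lemmas \<open>d_compl_d_map\<close> and
  \<open>g_compl_g_map\<close> below give the defining equations.\<close>

definition d_compl :: "('a, 'm) mv_scheme \<Rightarrow> ('a \<Rightarrow> 'a) \<Rightarrow> 'a \<Rightarrow> 'a"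
  where "d_compl L f = d_map L (neg\<^bsub>L\<^esub> (THE a. a \<in> boolean_center L \<and> f = d_map L a))"

definition g_compl :: "('a, 'm) mv_scheme \<Rightarrow> ('a \<Rightarrow> 'a) \<Rightarrow> 'a \<Rightarrow> 'a"
  where "g_compl L f = g_map L (neg\<^bsub>L\<^esub> (THE a. a \<in> boolean_center L \<and> f = g_map L a))"

lemma (in mv_algebra) d_map_one:
  assumes "a \<in> carrier L"
  shows "d_map L a (neg \<zero>) = a"
proof -
  have "neg (neg \<zero>) \<oplus> neg a = neg a"
    using assms by (simp add: neg_neg neg_closed zero_closed plus_zero plus_comm[of \<zero>])
  then show ?thesis
    using assms by (simp add: d_map_def mv_times_def neg_neg neg_closed zero_closed)
qed

lemma (in mv_algebra) g_map_zero:
  assumes "a \<in> carrier L"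
  shows "g_map L a \<zero> = a"
  using assms by (simp add: g_map_def zero_closed plus_zero)

lemma (in mv_algebra) d_compl_d_map:
  assumes "a \<in> boolean_center L"
  shows "d_compl L (d_map L a) = d_map L (neg a)"
proof -
  have "(THE b. b \<in> boolean_center L \<and> d_map L a = d_map L b) = a"
    using assms by (intro the_equality) (auto simp: boolean_center_def dest: d_map_one, metis d_map_one)
  then show ?thesis by (simp add: d_compl_def)
qed

lemma (in mv_algebra) g_compl_g_map:
  assumes "a \<in> boolean_center L"
  shows "g_compl L (g_map L a) = g_map L (neg a)"
proof -
  have "(THE b. b \<in> boolean_center L \<and> g_map L a = g_map L b) = a"
    using assms by (intro the_equality) (auto simp: boolean_center_def dest: g_map_zero, metis g_map_zero)
  then show ?thesis by (simp add: g_compl_def)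
qed

record 'a bool_alg = "'a partial_object" +
  ba_meet  :: "['a, 'a] \<Rightarrow> 'a"
  ba_join  :: "['a, 'a] \<Rightarrow> 'a"
  ba_compl :: "'a \<Rightarrow> 'a"
  ba_bot   :: "'a"
  ba_top   :: "'a"

locale boolean_alg =
  fixes A :: "('a, 'm) bool_alg_scheme"
  assumes meet_closed: "\<lbrakk>x \<in> carrier A; y \<in> carrier A\<rbrakk> \<Longrightarrow> ba_meet A x y \<in> carrier A"
    and join_closed: "\<lbrakk>x \<in> carrier A; y \<in> carrier A\<rbrakk> \<Longrightarrow> ba_join A x y \<in> carrier A"
    and compl_closed: "x \<in> carrier A \<Longrightarrow> ba_compl A x \<in> carrier A"
    and bot_closed: "ba_bot A \<in> carrier A"
    and top_closed: "ba_top A \<in> carrier A"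
    and meet_assoc: "\<lbrakk>x \<in> carrier A; y \<in> carrier A; z \<in> carrier A\<rbrakk>
          \<Longrightarrow> ba_meet A (ba_meet A x y) z = ba_meet A x (ba_meet A y z)"
    and join_assoc: "\<lbrakk>x \<in> carrier A; y \<in> carrier A; z \<in> carrier A\<rbrakk>
          \<Longrightarrow> ba_join A (ba_join A x y) z = ba_join A x (ba_join A y z)"
    and meet_comm: "\<lbrakk>x \<in> carrier A; y \<in> carrier A\<rbrakk> \<Longrightarrow> ba_meet A x y = ba_meet A y x"
    and join_comm: "\<lbrakk>x \<in> carrier A; y \<in> carrier A\<rbrakk> \<Longrightarrow> ba_join A x y = ba_join A y x"
    and meet_join_absorb: "\<lbrakk>x \<in> carrier A; y \<in> carrier A\<rbrakk> \<Longrightarrow> ba_meet A x (ba_join A x y) = x"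
    and join_meet_absorb: "\<lbrakk>x \<in> carrier A; y \<in> carrier A\<rbrakk> \<Longrightarrow> ba_join A x (ba_meet A x y) = x"
    and meet_join_distrib: "\<lbrakk>x \<in> carrier A; y \<in> carrier A; z \<in> carrier A\<rbrakk>
          \<Longrightarrow> ba_meet A x (ba_join A y z) = ba_join A (ba_meet A x y) (ba_meet A x z)"
    and join_bot: "x \<in> carrier A \<Longrightarrow> ba_join A x (ba_bot A) = x"
    and meet_top: "x \<in> carrier A \<Longrightarrow> ba_meet A x (ba_top A) = x"
    and meet_compl: "x \<in> carrier A \<Longrightarrow> ba_meet A x (ba_compl A x) = ba_bot A"
    and join_compl: "x \<in> carrier A \<Longrightarrow> ba_join A x (ba_compl A x) = ba_top A"

definition boolean_alg_iso ::
    "('a, 'm) bool_alg_scheme \<Rightarrow> ('b, 'n) bool_alg_scheme \<Rightarrow> ('a \<Rightarrow> 'b) set"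
  where "boolean_alg_iso A B = {h.
    bij_betw h (carrier A) (carrier B) \<and>
    (\<forall>x\<in>carrier A. \<forall>y\<in>carrier A. h (ba_meet A x y) = ba_meet B (h x) (h y)) \<and>
    (\<forall>x\<in>carrier A. \<forall>y\<in>carrier A. h (ba_join A x y) = ba_join B (h x) (h y)) \<and>
    (\<forall>x\<in>carrier A. h (ba_compl A x) = ba_compl B (h x)) \<and>
    h (ba_bot A) = ba_bot B \<and> h (ba_top A) = ba_top B}"

definition boolean_alg_isomorphic ::
    "('a, 'm) bool_alg_scheme \<Rightarrow> ('b, 'n) bool_alg_scheme \<Rightarrow> bool" (infix "\<cong>\<^sub>B" 50)
  where "A \<cong>\<^sub>B B \<longleftrightarrow> boolean_alg_iso A B \<noteq> {}"

definition L_alg :: "('a, 'm) mv_scheme \<Rightarrow> 'a bool_alg"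
  where "L_alg L = \<lparr>carrier = carrier L, ba_meet = mv_meet L, ba_join = mv_join L,
    ba_compl = mv_neg L, ba_bot = mv_zero L, ba_top = mv_one L\<rparr>"

definition D_alg :: "('a, 'm) mv_scheme \<Rightarrow> ('a \<Rightarrow> 'a) bool_alg"
  where "D_alg L = \<lparr>carrier = D_set L, ba_meet = pointwise_meet L, ba_join = pointwise_join L,
    ba_compl = d_compl L, ba_bot = d_map L (mv_zero L), ba_top = d_map L (mv_one L)\<rparr>"

definition G_alg :: "('a, 'm) mv_scheme \<Rightarrow> ('a \<Rightarrow> 'a) bool_alg"
  where "G_alg L = \<lparr>carrier = G_set L, ba_meet = pointwise_meet L, ba_join = pointwise_join L,
    ba_compl = g_compl L, ba_bot = g_map L (mv_zero L), ba_top = g_map L (mv_one L)\<rparr>"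

end

theory Submission
  imports Defs
begin

text \<open>In a Boolean MV-algebra the lattice operations are just \<open>\<oplus>\<close> and \<open>\<odot>\<close>, and residuation
  makes \<open>\<odot>\<close> distribute over \<open>\<oplus>\<close>. The maps \<open>a \<mapsto> d_a\<close> and \<open>a \<mapsto> g_a\<close> are injective because
  \<open>d_a\<close> and \<open>g_a\<close> give back \<open>a\<close> at the top and at the bottom element, and they preserve the
  operations by the two distributive laws. The Boolean algebra axioms are carried over along
  these bijections.\<close>

context mv_algebra
begin

lemma plus_left_comm:
  assumes "x \<in> carrier L" "y \<in> carrier L" "z \<in> carrier L"
  shows "x \<oplus> (y \<oplus> z) = y \<oplus> (x \<oplus> z)"
  using assms plus_assoc[of x y z] plus_assoc[of y x z] plus_comm[of x y] by simp

lemma zero_plus: "x \<in> carrier L \<Longrightarrow> \<zero> \<oplus> x = x"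
  using plus_zero plus_comm zero_closed by simp

lemma one_closed: "\<one> \<in> carrier L"
  by (simp add: mv_one_def neg_closed zero_closed)

lemma neg_one: "neg \<one> = \<zero>"
  by (simp add: mv_one_def neg_neg zero_closed)

lemma plus_one: "x \<in> carrier L \<Longrightarrow> x \<oplus> \<one> = \<one>"
  by (simp add: mv_one_def plus_neg_zero)

lemma one_plus: "x \<in> carrier L \<Longrightarrow> \<one> \<oplus> x = \<one>"
  using plus_one plus_comm one_closed by simp

text \<open>Instance \<open>y = \<one>\<close> of the Lukasiewicz axiom: one side collapses to
  \<open>\<one>\<close>, the other to \<open>neg x \<oplus> x\<close>.\<close>

lemma neg_plus_self:
  assumes "x \<in> carrier L"
  shows "neg x \<oplus> x = \<one>"
  using lukasiewicz[OF assms one_closed] assms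
  by (simp add: plus_one neg_one neg_closed zero_plus one_closed zero_closed)

lemma neg_plus_plus_self:
  assumes "x \<in> carrier L" "y \<in> carrier L"
  shows "neg x \<oplus> (x \<oplus> y) = \<one>"
  using assms plus_assoc[of "neg x" x y] by (simp add: neg_plus_self one_plus neg_closed)

lemma plus_self_neg: "x \<in> carrier L \<Longrightarrow> x \<oplus> neg x = \<one>"
  using neg_plus_self plus_comm neg_closed by simp

text \<open>The equation \<open>neg x \<oplus> y = \<one>\<close> encodes \<open>x \<le> y\<close>
  in the natural order. Under both hypotheses the two sides of the Lukasiewicz axiom reduce to
  \<open>y\<close> and to \<open>x\<close>.\<close>

lemma antisym:
  assumes "x \<in> carrier L" "y \<in> carrier L" "neg x \<oplus> y = \<one>" "neg y \<oplus> x = \<one>"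
  shows "x = y"
  using lukasiewicz[OF assms(1,2)] assms by (simp add: neg_one zero_plus)

lemma times_closed: "\<lbrakk>x \<in> carrier L; y \<in> carrier L\<rbrakk> \<Longrightarrow> x \<odot> y \<in> carrier L"
  by (simp add: mv_times_def plus_closed neg_closed)

lemma times_comm: "\<lbrakk>x \<in> carrier L; y \<in> carrier L\<rbrakk> \<Longrightarrow> x \<odot> y = y \<odot> x"
  by (simp add: mv_times_def plus_comm neg_closed)

lemma times_assoc:
  "\<lbrakk>x \<in> carrier L; y \<in> carrier L; z \<in> carrier L\<rbrakk> \<Longrightarrow> (x \<odot> y) \<odot> z = x \<odot> (y \<odot> z)"
  by (simp add: mv_times_def plus_assoc neg_closed neg_neg plus_closed)

lemma times_left_comm:
  assumes "x \<in> carrier L" "y \<in> carrier L" "z \<in> carrier L"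
  shows "x \<odot> (y \<odot> z) = y \<odot> (x \<odot> z)"
  using assms times_assoc[of x y z] times_assoc[of y x z] times_comm[of x y] by simp

text \<open>Unfolding the meet gives the negated join of \<open>neg y\<close> and
  \<open>neg x\<close>; the Lukasiewicz axiom is exactly the symmetry of the join.\<close>

lemma meet_eq_neg_join:
  assumes "x \<in> carrier L" "y \<in> carrier L"
  shows "x \<sqinter> y = neg (neg x \<squnion> neg y)"
  using assms lukasiewicz[of "neg x" "neg y"]
  by (simp add: mv_meet_def mv_join_def mv_times_def neg_neg neg_closed plus_closed plus_comm)

end

context boolean_mv_algebra
begin

lemma plus_left_idem: "\<lbrakk>x \<in> carrier L; y \<in> carrier L\<rbrakk> \<Longrightarrow> x \<oplus> (x \<oplus> y) = x \<oplus> y"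
  using plus_assoc[of x x y] plus_idem by simp

lemma join_eq_plus:
  assumes x: "x \<in> carrier L" and y: "y \<in> carrier L"
  shows "x \<squnion> y = x \<oplus> y"
proof -
  define u where "u = neg x \<oplus> y"
  have u: "u \<in> carrier L" using x y by (simp add: u_def plus_closed neg_closed)
  define j where "j = neg u \<oplus> y"
  have j: "j \<in> carrier L" using u y by (simp add: j_def plus_closed neg_closed)
  have join: "x \<squnion> y = j"
    using x y by (simp add: mv_join_def mv_times_def j_def u_def neg_neg)
  \<comment> \<open>With both forms of \<open>j\<close> at hand, idempotence lets \<open>j\<close>
    absorb \<open>y\<close> from the first and \<open>x\<close> from the second.\<close>
  have j_sym: "j = neg (neg y \<oplus> x) \<oplus> x"
    unfolding j_def u_def using lukasiewicz[OF x y] .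
  have "j \<oplus> y = j" using u y by (simp add: j_def plus_assoc plus_idem neg_closed)
  moreover have "j \<oplus> x = j"
    using x y by (simp add: j_sym plus_assoc plus_idem neg_closed plus_closed)
  ultimately have j_absorb: "(x \<oplus> y) \<oplus> j = j"
    using x y j by (metis plus_assoc plus_closed plus_comm)
  \<comment> \<open>Since \<open>y\<close> lies below \<open>u\<close>, the join of \<open>u\<close>
    and \<open>y\<close> is \<open>u\<close>; unfolded, this join is
    \<open>neg j \<oplus> y\<close>.\<close>
  have "neg y \<oplus> u = \<one>"
    using x y by (metis u_def neg_closed neg_plus_plus_self plus_comm)
  then have "neg j \<oplus> y = u"
    using lukasiewicz[OF u y] u by (simp add: j_def neg_one zero_plus)
  then have "neg j \<oplus> (x \<oplus> y) = x \<oplus> u"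
    using x y j by (metis neg_closed plus_left_comm)
  also have "\<dots> = \<one>"
    using x y by (metis u_def neg_closed neg_plus_plus_self neg_neg)
  finally have "neg j \<oplus> (x \<oplus> y) = \<one>" .
  moreover have "neg (x \<oplus> y) \<oplus> j = \<one>"
    using j_absorb neg_plus_plus_self[of "x \<oplus> y" j] x y j by (simp add: plus_closed)
  ultimately show ?thesis
    using antisym[of j "x \<oplus> y"] x y j join by (simp add: plus_closed)
qed

lemma meet_eq_times:
  "\<lbrakk>x \<in> carrier L; y \<in> carrier L\<rbrakk> \<Longrightarrow> x \<sqinter> y = x \<odot> y"
  by (simp add: meet_eq_neg_join join_eq_plus neg_closed mv_times_def)

text \<open>Two descriptions of \<open>x \<le> y\<close>. From right to left, the definition of the
  join reduces \<open>x \<squnion> y\<close> to \<open>y\<close>, and the join is the sum.\<close>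

lemma absorb_iff:
  assumes "x \<in> carrier L" "y \<in> carrier L"
  shows "x \<oplus> y = y \<longleftrightarrow> neg x \<oplus> y = \<one>"
  using assms join_eq_plus[OF assms] neg_plus_plus_self[OF assms]
  by (auto simp: mv_join_def mv_times_def neg_neg neg_one zero_plus)

text \<open>Residuation: \<open>x \<odot> y\<close> is below \<open>z\<close> iff \<open>y\<close>
  is below \<open>neg x \<oplus> z\<close>. By \<open>absorb_iff\<close> both sides say that the sum
  of \<open>neg x\<close>, \<open>neg y\<close> and \<open>z\<close> is
  \<open>\<one>\<close>.\<close>

lemma times_absorb_iff:
  assumes "x \<in> carrier L" "y \<in> carrier L" "z \<in> carrier L"
  shows "(x \<odot> y) \<oplus> z = z \<longleftrightarrow> y \<oplus> (neg x \<oplus> z) = neg x \<oplus> z"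
  using assms
  by (simp add: absorb_iff mv_times_def neg_neg neg_closed plus_closed plus_assoc
      plus_left_comm)

lemma plus_times_absorb:
  assumes "x \<in> carrier L" "y \<in> carrier L"
  shows "x \<oplus> (x \<odot> y) = x"
  using assms times_absorb_iff[of x y x]
  by (simp add: times_closed plus_comm[of x] neg_plus_self plus_one)

lemma times_plus_absorb:
  assumes "x \<in> carrier L" "y \<in> carrier L"
  shows "x \<odot> (x \<oplus> y) = x"
  using assms plus_times_absorb[of "neg x" "neg y"]
  by (simp add: mv_times_def neg_closed neg_neg plus_closed)

text \<open>Multiplication by \<open>x\<close> is a left adjoint by residuation, hence preserves
  joins; the two inequalities \<open>v \<le> w\<close> and \<open>w \<le> v\<close> are written as
  absorptions.\<close>

lemma times_plus_distrib:
  assumes x: "x \<in> carrier L" and y: "y \<in> carrier L" and z: "z \<in> carrier L"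
  shows "x \<odot> (y \<oplus> z) = (x \<odot> y) \<oplus> (x \<odot> z)"
proof -
  define w where "w = (x \<odot> y) \<oplus> (x \<odot> z)"
  define v where "v = x \<odot> (y \<oplus> z)"
  note closed = plus_closed times_closed neg_closed
  have w: "w \<in> carrier L" and v: "v \<in> carrier L"
    using x y z by (simp_all add: w_def v_def closed)
  have "(x \<odot> y) \<oplus> w = w" "(x \<odot> z) \<oplus> w = w"
    using x y z by (simp_all add: w_def closed plus_idem plus_left_idem
        plus_comm plus_left_comm)
  then have "(y \<oplus> z) \<oplus> (neg x \<oplus> w) = neg x \<oplus> w"
    using x y z w by (simp add: times_absorb_iff closed plus_assoc)
  then have "v \<oplus> w = w"
    using x y z w by (simp add: v_def times_absorb_iff closed)
  \<comment> \<open>\<open>p\<close> is the residual of \<open>v\<close> by \<open>x\<close>: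
    transposing \<open>v \<le> v\<close> puts \<open>y \<oplus> z\<close> below \<open>p\<close>,
    hence also \<open>y\<close> and \<open>z\<close>, and transposing back bounds both products by
    \<open>v\<close>.\<close>
  define p where "p = neg x \<oplus> v"
  have p: "p \<in> carrier L" using x v by (simp add: p_def closed)
  have "(y \<oplus> z) \<oplus> p = p"
    using x y z v times_absorb_iff[of x "y \<oplus> z" v]
    by (simp add: v_def[symmetric] p_def closed plus_idem)
  then have "y \<oplus> p = p" "z \<oplus> p = p"
    using y z p by (metis plus_assoc plus_closed plus_comm plus_left_idem)+
  then have "(x \<odot> y) \<oplus> v = v" "(x \<odot> z) \<oplus> v = v"
    using x y z v by (simp_all add: times_absorb_iff p_def)
  then have "w \<oplus> v = v"
    using x y z v by (simp add: w_def closed plus_assoc)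
  with \<open>v \<oplus> w = w\<close> show ?thesis
    using v w plus_comm[of v w] by (simp add: v_def w_def)
qed

text \<open>De Morgan dual of \<open>times_plus_distrib\<close>, taken at the negated
  arguments.\<close>

lemma plus_times_distrib:
  assumes "x \<in> carrier L" "y \<in> carrier L" "z \<in> carrier L"
  shows "x \<oplus> (y \<odot> z) = (x \<oplus> y) \<odot> (x \<oplus> z)"
proof -
  have "neg (neg x \<odot> (neg y \<oplus> neg z)) = neg ((neg x \<odot> neg y) \<oplus> (neg x \<odot> neg z))"
    using assms by (simp add: times_plus_distrib neg_closed)
  then show ?thesis
    using assms by (simp add: mv_times_def neg_closed neg_neg plus_closed)
qed

lemma boolean_alg_L_alg: "boolean_alg (L_alg L)"
proof -
  have "x \<odot> \<one> = x" "x \<odot> neg x = \<zero>" if "x \<in> carrier L" for x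
    using that by (simp_all add: mv_times_def neg_one neg_closed plus_zero neg_neg neg_plus_self)
  then show ?thesis
    by unfold_locales
      (simp_all add: L_alg_def join_eq_plus meet_eq_times plus_closed times_closed neg_closed
        zero_closed one_closed plus_assoc times_assoc times_plus_absorb plus_times_absorb
        times_plus_distrib plus_zero plus_self_neg plus_comm times_comm
        plus_left_comm times_left_comm)
qed

text \<open>Makes the carrier of \<open>L_alg L\<close> the index set of both \<open>D_set L\<close>
  and \<open>G_set L\<close>.\<close>

lemma boolean_center_eq: "boolean_center L = carrier L"
  by (auto simp: boolean_center_def plus_idem)

lemma d_map_iso: "d_map L \<in> boolean_alg_iso (L_alg L) (D_alg L)"
proof -
  have "inj_on (d_map L) (carrier L)"
    using d_map_one by (metis inj_onI)
  moreover have "d_map L ` carrier L = D_set L"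
    by (auto simp: D_set_def boolean_center_eq)
  moreover have "d_map L (a \<sqinter> b) = pointwise_meet L (d_map L a) (d_map L b)"
    if a: "a \<in> carrier L" and b: "b \<in> carrier L" for a b
  proof -
    \<comment> \<open>Idempotence of \<open>\<odot>\<close> supplies the second copy of
      \<open>x\<close>.\<close>
    have "x \<odot> (a \<odot> b) = (x \<odot> a) \<odot> (x \<odot> b)" if x: "x \<in> carrier L" for x
    proof -
      have "x \<odot> x = x" using x by (simp add: mv_times_def plus_idem neg_closed neg_neg)
      then show ?thesis using x a b by (metis times_assoc times_closed times_left_comm)
    qed
    then show ?thesis
      using a b by (auto simp: d_map_def pointwise_meet_def meet_eq_times times_closed)
  qed
  moreover have "d_map L (a \<squnion> b) = pointwise_join L (d_map L a) (d_map L b)"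
    if "a \<in> carrier L" "b \<in> carrier L" for a b
    using that
    by (auto simp: d_map_def pointwise_join_def join_eq_plus times_closed times_plus_distrib)
  \<comment> \<open>Complements are handled by \<open>d_compl_d_map\<close>; bottom and top agree by
    definition.\<close>
  ultimately show ?thesis
    by (simp add: boolean_alg_iso_def bij_betw_def L_alg_def D_alg_def d_compl_d_map
        boolean_center_eq)
qed

lemma g_map_iso: "g_map L \<in> boolean_alg_iso (L_alg L) (G_alg L)"
proof -
  have "inj_on (g_map L) (carrier L)"
    using g_map_zero by (metis inj_onI)
  moreover have "g_map L ` carrier L = G_set L"
    by (auto simp: G_set_def boolean_center_eq)
  moreover have "g_map L (a \<sqinter> b) = pointwise_meet L (g_map L a) (g_map L b)"
    if "a \<in> carrier L" "b \<in> carrier L" for a b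
    using that
    by (auto simp: g_map_def pointwise_meet_def meet_eq_times plus_closed times_closed
        plus_times_distrib plus_comm)
  moreover have "g_map L (a \<squnion> b) = pointwise_join L (g_map L a) (g_map L b)"
    if a: "a \<in> carrier L" and b: "b \<in> carrier L" for a b
    \<comment> \<open>Here idempotence merges the two copies of \<open>x\<close> in
      \<open>(a \<oplus> x) \<oplus> (b \<oplus> x)\<close>.\<close>
    using a b
    by (auto simp: g_map_def pointwise_join_def join_eq_plus plus_closed plus_assoc plus_idem
        plus_comm plus_left_comm plus_left_idem)
  ultimately show ?thesis
    by (simp add: boolean_alg_iso_def bij_betw_def L_alg_def G_alg_def g_compl_g_map
        boolean_center_eq)
qed

end

text \<open>The axioms are closure conditions and equations. Every element of
  \<open>carrier B\<close> is an image under \<open>h\<close>, and \<open>hom\<close> moves the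
  operations inside \<open>h\<close>, so each axiom of \<open>B\<close> follows from the same axiom
  of \<open>A\<close>.\<close>

lemma boolean_alg_iso_transfer:
  assumes "boolean_alg A" and iso: "h \<in> boolean_alg_iso A B"
  shows "boolean_alg B"
proof -
  interpret A: boolean_alg A by fact
  have carrier_B: "carrier B = h ` carrier A"
    using iso by (simp add: boolean_alg_iso_def bij_betw_def)
  have hom:
    "\<And>x y. \<lbrakk>x \<in> carrier A; y \<in> carrier A\<rbrakk> \<Longrightarrow> ba_meet B (h x) (h y) = h (ba_meet A x y)"
    "\<And>x y. \<lbrakk>x \<in> carrier A; y \<in> carrier A\<rbrakk> \<Longrightarrow> ba_join B (h x) (h y) = h (ba_join A x y)"
    "\<And>x. x \<in> carrier A \<Longrightarrow> ba_compl B (h x) = h (ba_compl A x)"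
    "ba_bot B = h (ba_bot A)" "ba_top B = h (ba_top A)"
    using iso by (simp_all add: boolean_alg_iso_def)
  note closed = A.meet_closed A.join_closed A.compl_closed A.bot_closed A.top_closed
  show ?thesis
    by unfold_locales
      (auto simp: carrier_B hom closed A.meet_assoc A.join_assoc A.meet_join_absorb
        A.join_meet_absorb A.meet_join_distrib A.join_bot A.meet_top A.meet_compl A.join_compl
        intro!: arg_cong[where f = h] intro: A.meet_comm A.join_comm)
qed

theorem theorem4p25:
  fixes L :: "('a, 'm) mv_scheme"
  assumes "boolean_mv_algebra L"
  shows "boolean_alg (L_alg L) \<and>
    (boolean_alg (D_alg L) \<and> L_alg L \<cong>\<^sub>B D_alg L) \<and>
    (boolean_alg (G_alg L) \<and> L_alg L \<cong>\<^sub>B G_alg L)"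
proof -
  interpret boolean_mv_algebra L by fact
  show ?thesis
    using boolean_alg_L_alg d_map_iso g_map_iso boolean_alg_iso_transfer
    unfolding boolean_alg_isomorphic_def by blast
qed

end
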